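(* Let $\mathcal{P}$ be a well-formed integer program, let $\alpha\in\mathcal{P}$ be a simple recursion of degree $d$ such that $\mathrm{guard}(\alpha)\implies\mathrm{cost}(\alpha)\geq 1$ is valid, and let $\chi_\psi\cdot b$ be a metering function for $\alpha$. Let $\alpha'$ be the rule \[ \mathrm{lhs}(\alpha)\xrightarrow{c}\emptyset\ [\mathrm{guard}(\alpha)\land\psi]\quad\text{where } c=\frac{d^b-1}{d-1}, \] and let $\mathcal{P}'=\mathcal{P}\cup\{\alpha'\}$. Then $\mathcal{P}'$ is well formed and the processor mapping $\mathcal{P}$ to $\mathcal{P}'$ is sound.
   Context: Fix a finite set $\Sigma$ of function symbols of common arity $k$ containing a start symbol $f_0$, and variables ranging over $\mathbb{Z}$. Arithmetic expressions are built from variables, numbers and operations such as $+,-,\cdot$, division, exponentiation; a constraint is a finite conjunction of inequations between arithmetic expressions. A rule has the form $f(\vec x)\xrightarrow{c}T\ [\varphi]$ where $\vec x=(x_1,\dots,x_k)$ is a fixed vector of pairwise different program variables, $f\in\Sigma$, $c$ an arithmetic expression (cost), $T$ a finite multiset of terms $g(t_1,\dots,t_k)$ ($g\in\Sigma$, $t_i$ arithmetic expressions), $\varphi$ a constraint (guard); the degree of a rule is $|T|$. An integer program is a finite set of rules in which $f_0$ does not occur on right-hand sides. Substitutions map variables to arithmetic expressions, applied homomorphically; $\{\vec x/\vec t\}$ maps $x_i$ to $t_i$. An integer substitution maps variables of its domain to integers; $\sigma\models\varphi$ means all variables of $\varphi$ are in $\mathrm{dom}(\sigma)$ and $\sigma$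 models $\varphi$; $\sigma\models\alpha$ means all variables of $\alpha$ are in $\mathrm{dom}(\sigma)$ and $\sigma\models\mathrm{guard}(\alpha)$. A formula is valid if every integer substitution whose domain contains its variables models it. For a constraint $\psi$, $\chi_\psi\sigma=1$ if $\sigma\models\psi$ and $0$ otherwise. A configuration is a finite multiset of terms $f(n_1,\dots,n_k)$, $n_i\in\mathbb{Z}$. $S\xrightarrow{k}_{\mathcal{P}}T$ if there are $s\in S$, a rule $f(\vec x)\xrightarrow{c}Q\ [\varphi]$ in $\mathcal{P}$ and an integer substitution $\sigma$ covering the rule's variables with $f(\vec x)\sigma=s$, $\sigma\models\varphi$, $c\sigma=k$, $T=(S\setminus\{s\})\cup Q\sigma$; costs of sequences are summed. $\mathrm{dh}_{\mathcal{P}}(S)=\sup\{k\mid S\xrightarrow{k}{}^{*}_{\mathcal{P}}T\}$, $\mathrm{rc}_{\mathcal{P}}(n)=\sup\{\mathrm{dh}_{\mathcal{P}}(f_0(\vec n))\mid\vec n\in\mathbb{Z}^k,\sum_i|n_i|\leq n\}$. A rule $\alpha$ is well formed if $t_i\sigma\in\mathbb{Z}$ for all $f(t_1,\dots,t_k)\in\mathrm{rhs}(\alpha)$, all $i$ and all integer $\sigma\models\alpha$; a program is well formed if all its rules are. A processor is a partial function on integer programs; it is sound if $\mathrm{rc}_{\mathcal{P}}(n)\geq\mathrm{rc}_{\mathrm{proc}(\mathcal{P})}(n)$ for all $n\in\mathbb{N}$ and all $\mathcal{P}$ where it is defined. A simple recursion is a rule $f(\vec x)\xrightarrow{c}T\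 [\varphi]$ with $|T|>1$ in which every term of $T$ has root $f$. An expression $b$ is a metering function for such a rule $\alpha$ if $\neg\mathrm{guard}(\alpha)\implies b\leq0$ is valid and $\mathrm{guard}(\alpha)\implies b\{\vec x/\vec t\}\geq b-1$ is valid for all $f(\vec t)\in T$. *)

theory Defs
  imports Complex_Main "HOL-Library.Multiset" "HOL-Library.Extended_Real"
begin

section \<open>Arithmetic expressions and constraints\<close>

text \<open>
  A constraint is the list of its conjuncts. The expression \<open>Chi \<psi> t\<close> is the product of
  the characteristic function of \<open>\<psi>\<close> with \<open>t\<close>; as usual for such products its value is \<open>0\<close> wherever
  \<open>\<psi>\<close> fails, even if \<open>t\<close> is undefined there. The characteristic function itself is \<open>Chi \<psi> (Num 1)\<close>.
\<close>

datatype (vars: 'v) aexp =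
    Var 'v
  | Num real
  | Add "'v aexp" "'v aexp"
  | Sub "'v aexp" "'v aexp"
  | Mul "'v aexp" "'v aexp"
  | Div "'v aexp" "'v aexp"
  | Pow "'v aexp" "'v aexp"
  | Chi "'v ineq list" "'v aexp"
and (ineq_vars: 'v) ineq =
    Le "'v aexp" "'v aexp"
  | Less "'v aexp" "'v aexp"

type_synonym 'v constraint = "'v ineq list"

definition constraint_vars :: "'v constraint \<Rightarrow> 'v set" where
  "constraint_vars \<phi> = (\<Union>i\<in>set \<phi>. ineq_vars i)"

type_synonym 'v subst = "'v \<rightharpoonup> 'v aexp"
type_synonym 'v int_subst = "'v \<rightharpoonup> int"

primrec subst :: "'v subst \<Rightarrow> 'v aexp \<Rightarrow> 'v aexp"
  and subst_ineq :: "'v subst \<Rightarrow> 'v ineq \<Rightarrow> 'v ineq"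
where
  "subst \<theta> (Var x) = (case \<theta> x of None \<Rightarrow> Var x | Some t \<Rightarrow> t)"
| "subst \<theta> (Num r) = Num r"
| "subst \<theta> (Add s t) = Add (subst \<theta> s) (subst \<theta> t)"
| "subst \<theta> (Sub s t) = Sub (subst \<theta> s) (subst \<theta> t)"
| "subst \<theta> (Mul s t) = Mul (subst \<theta> s) (subst \<theta> t)"
| "subst \<theta> (Div s t) = Div (subst \<theta> s) (subst \<theta> t)"
| "subst \<theta> (Pow s t) = Pow (subst \<theta> s) (subst \<theta> t)"
| "subst \<theta> (Chi \<psi> t) = Chi (map (subst_ineq \<theta>) \<psi>) (subst \<theta> t)"
| "subst_ineq \<theta> (Le s t) = Le (subst \<theta> s) (subst \<theta> t)"
| "subst_ineq \<theta> (Less s t) = Less (subst \<theta> s) (subst \<theta> t)"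

text \<open>
  Division by zero and powers without a real value are undefined (\<open>None\<close>). The operation \<open>powr\<close>
  has the intended meaning for positive bases only; other bases are handled separately.
\<close>

definition div_opt :: "real \<Rightarrow> real \<Rightarrow> real option" where
  "div_opt a r = (if r = 0 then None else Some (a / r))"

definition pow_opt :: "real \<Rightarrow> real \<Rightarrow> real option" where
  "pow_opt a r =
    (if a > 0 then Some (a powr r)
     else if r \<in> \<int> \<and> (a \<noteq> 0 \<or> r \<ge> 0) then Some (a powi \<lfloor>r\<rfloor>)
     else if a = 0 \<and> r > 0 then Some 0
     else None)"

definition lift_opt :: "(real \<Rightarrow> real \<Rightarrow> real option) \<Rightarrow> real option \<Rightarrow> real option \<Rightarrow> real option" where
  "lift_opt g u v = Option.bind u (\<lambda>a. Option.bind v (g a))"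

text \<open>
  An inequation with an undefined side does not hold.
\<close>

fun eval :: "'v int_subst \<Rightarrow> 'v aexp \<Rightarrow> real option"
  and holds :: "'v int_subst \<Rightarrow> 'v ineq \<Rightarrow> bool"
  and models :: "'v int_subst \<Rightarrow> 'v constraint \<Rightarrow> bool"
where
  "eval \<sigma> (Var x) = map_option real_of_int (\<sigma> x)"
| "eval \<sigma> (Num r) = Some r"
| "eval \<sigma> (Add s t) = lift_opt (\<lambda>a r. Some (a + r)) (eval \<sigma> s) (eval \<sigma> t)"
| "eval \<sigma> (Sub s t) = lift_opt (\<lambda>a r. Some (a - r)) (eval \<sigma> s) (eval \<sigma> t)"
| "eval \<sigma> (Mul s t) = lift_opt (\<lambda>a r. Some (a * r)) (eval \<sigma> s) (eval \<sigma> t)"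
| "eval \<sigma> (Div s t) = lift_opt div_opt (eval \<sigma> s) (eval \<sigma> t)"
| "eval \<sigma> (Pow s t) = lift_opt pow_opt (eval \<sigma> s) (eval \<sigma> t)"
| "eval \<sigma> (Chi \<psi> t) = (if models \<sigma> \<psi> then eval \<sigma> t else Some 0)"
| "holds \<sigma> (Le s t) \<longleftrightarrow> (\<exists>a r. eval \<sigma> s = Some a \<and> eval \<sigma> t = Some r \<and> a \<le> r)"
| "holds \<sigma> (Less s t) \<longleftrightarrow> (\<exists>a r. eval \<sigma> s = Some a \<and> eval \<sigma> t = Some r \<and> a < r)"
| "models \<sigma> \<phi> \<longleftrightarrow> constraint_vars \<phi> \<subseteq> dom \<sigma> \<and> (\<forall>i\<in>set \<phi>. holds \<sigma> i)"

datatype (formula_vars: 'v) formula =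
    Constr "'v constraint"
  | Neg "'v formula"
  | Imp "'v formula" "'v formula"

primrec formula_models :: "'v int_subst \<Rightarrow> 'v formula \<Rightarrow> bool" where
  "formula_models \<sigma> (Constr \<phi>) \<longleftrightarrow> models \<sigma> \<phi>"
| "formula_models \<sigma> (Neg F) \<longleftrightarrow> \<not> formula_models \<sigma> F"
| "formula_models \<sigma> (Imp F G) \<longleftrightarrow> (formula_models \<sigma> F \<longrightarrow> formula_models \<sigma> G)"

definition valid :: "'v formula \<Rightarrow> bool" where
  "valid F \<longleftrightarrow> (\<forall>\<sigma>. formula_vars F \<subseteq> dom \<sigma> \<longrightarrow> formula_models \<sigma> F)"


section \<open>Integer programs\<close>

text \<open>
  The vector \<open>xs\<close> of program variables is the same for all rules, so a rule stores only the root of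
  its left-hand side; the arity of all function symbols is \<open>length xs\<close>.
\<close>

datatype ('f, 'v) rule =
  Rule (root: 'f) (cost: "'v aexp") (rhs: "('f \<times> 'v aexp list) multiset") (guard: "'v constraint")

type_synonym ('f, 'v) program = "('f, 'v) rule set"
type_synonym 'f config = "('f \<times> int list) multiset"

definition is_rule :: "'f set \<Rightarrow> 'v list \<Rightarrow> ('f, 'v) rule \<Rightarrow> bool" where
  "is_rule \<Sigma> xs \<alpha> \<longleftrightarrow>
    root \<alpha> \<in> \<Sigma> \<and> (\<forall>(g, ts)\<in>#rhs \<alpha>. g \<in> \<Sigma> \<and> length ts = length xs)"

definition integer_program :: "'f set \<Rightarrow> 'f \<Rightarrow> 'v list \<Rightarrow> ('f, 'v) program \<Rightarrow> bool" where
  "integer_program \<Sigma> f0 xs P \<longleftrightarrow>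
    finite P \<and> (\<forall>\<alpha>\<in>P. is_rule \<Sigma> xs \<alpha> \<and> (\<forall>(g, ts)\<in>#rhs \<alpha>. g \<noteq> f0))"

definition degree :: "('f, 'v) rule \<Rightarrow> nat" where
  "degree \<alpha> = size (rhs \<alpha>)"

definition rule_vars :: "'v list \<Rightarrow> ('f, 'v) rule \<Rightarrow> 'v set" where
  "rule_vars xs \<alpha> =
    set xs \<union> vars (cost \<alpha>) \<union> (\<Union>(g, ts)\<in>set_mset (rhs \<alpha>). \<Union>t\<in>set ts. vars t)
      \<union> constraint_vars (guard \<alpha>)"

definition models_rule :: "'v list \<Rightarrow> 'v int_subst \<Rightarrow> ('f, 'v) rule \<Rightarrow> bool" where
  "models_rule xs \<sigma> \<alpha> \<longleftrightarrow> rule_vars xs \<alpha> \<subseteq> dom \<sigma> \<and> models \<sigma> (guard \<alpha>)"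

definition well_formed_rule :: "'v list \<Rightarrow> ('f, 'v) rule \<Rightarrow> bool" where
  "well_formed_rule xs \<alpha> \<longleftrightarrow>
    (\<forall>\<sigma>. models_rule xs \<sigma> \<alpha> \<longrightarrow>
      (\<forall>(g, ts)\<in>#rhs \<alpha>. \<forall>t\<in>set ts. \<exists>z::int. eval \<sigma> t = Some (of_int z)))"

definition well_formed :: "'v list \<Rightarrow> ('f, 'v) program \<Rightarrow> bool" where
  "well_formed xs P \<longleftrightarrow> (\<forall>\<alpha>\<in>P. well_formed_rule xs \<alpha>)"

definition eval_terms :: "'v int_subst \<Rightarrow> ('f \<times> 'v aexp list) multiset \<Rightarrow> ('f \<times> real option list) multiset" where
  "eval_terms \<sigma> Q = image_mset (\<lambda>(g, ts). (g, map (eval \<sigma>) ts)) Q"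

definition of_config :: "'f config \<Rightarrow> ('f \<times> real option list) multiset" where
  "of_config R = image_mset (\<lambda>(g, ns). (g, map (\<lambda>n. Some (real_of_int n)) ns)) R"

text \<open>
  The last but one conjunct says that the instantiated right-hand side is the configuration \<open>R\<close>; in
  particular all its arguments are defined and integral.
\<close>

definition step :: "'v list \<Rightarrow> ('f, 'v) program \<Rightarrow> 'f config \<Rightarrow> real \<Rightarrow> 'f config \<Rightarrow> bool" where
  "step xs P S k T \<longleftrightarrow>
    (\<exists>s \<alpha> \<sigma> R. s \<in># S \<and> \<alpha> \<in> P \<and> rule_vars xs \<alpha> \<subseteq> dom \<sigma>
      \<and> (root \<alpha>, map (\<lambda>x. the (\<sigma> x)) xs) = s
      \<and> models \<sigma> (guard \<alpha>)
      \<and> eval \<sigma> (cost \<alpha>) = Some k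
      \<and> eval_terms \<sigma> (rhs \<alpha>) = of_config R
      \<and> T = (S - {#s#}) + R)"

inductive steps :: "'v list \<Rightarrow> ('f, 'v) program \<Rightarrow> 'f config \<Rightarrow> real \<Rightarrow> 'f config \<Rightarrow> bool"
  for xs P
where
  steps_refl: "steps xs P S 0 S"
| steps_step: "step xs P S k T \<Longrightarrow> steps xs P T l U \<Longrightarrow> steps xs P S (k + l) U"

definition dh :: "'v list \<Rightarrow> ('f, 'v) program \<Rightarrow> 'f config \<Rightarrow> ereal" where
  "dh xs P S = Sup {ereal k | k T. steps xs P S k T}"

definition rc :: "'f \<Rightarrow> 'v list \<Rightarrow> ('f, 'v) program \<Rightarrow> nat \<Rightarrow> ereal" where
  "rc f0 xs P n =
    Sup {dh xs P {#(f0, ns)#} | ns. length ns = length xs \<and> (\<Sum>m\<leftarrow>ns. \<bar>m\<bar>) \<le> int n}"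


section \<open>Processors\<close>

definition processor ::
    "'f set \<Rightarrow> 'f \<Rightarrow> 'v list \<Rightarrow> (('f, 'v) program \<rightharpoonup> ('f, 'v) program) \<Rightarrow> bool" where
  "processor \<Sigma> f0 xs proc \<longleftrightarrow>
    (\<forall>P P'. proc P = Some P' \<longrightarrow> integer_program \<Sigma> f0 xs P \<and> integer_program \<Sigma> f0 xs P')"

definition sound ::
    "'f \<Rightarrow> 'v list \<Rightarrow> (('f, 'v) program \<rightharpoonup> ('f, 'v) program) \<Rightarrow> bool" where
  "sound f0 xs proc \<longleftrightarrow>
    (\<forall>P P' n. proc P = Some P' \<longrightarrow> rc f0 xs P n \<ge> rc f0 xs P' n)"


section \<open>Simple recursions and metering functions\<close>

definition simple_recursion :: "('f, 'v) rule \<Rightarrow> bool" where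
  "simple_recursion \<alpha> \<longleftrightarrow> degree \<alpha> > 1 \<and> (\<forall>(g, ts)\<in>#rhs \<alpha>. g = root \<alpha>)"

definition metering_function :: "'v list \<Rightarrow> ('f, 'v) rule \<Rightarrow> 'v aexp \<Rightarrow> bool" where
  "metering_function xs \<alpha> b \<longleftrightarrow>
    valid (Imp (Neg (Constr (guard \<alpha>))) (Constr [Le b (Num 0)])) \<and>
    (\<forall>(g, ts)\<in>#rhs \<alpha>.
      valid (Imp (Constr (guard \<alpha>))
        (Constr [Le (Sub b (Num 1)) (subst (map_of (zip xs ts)) b)])))"

definition accelerated_rule :: "('f, 'v) rule \<Rightarrow> 'v constraint \<Rightarrow> 'v aexp \<Rightarrow> ('f, 'v) rule" where
  "accelerated_rule \<alpha> \<psi> b =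
    (let d = Num (real (degree \<alpha>)) in
      Rule (root \<alpha>) (Div (Sub (Pow d b) (Num 1)) (Sub d (Num 1))) {#} (guard \<alpha> @ \<psi>))"

end

theory Submission
  imports Defs
begin

text \<open>
  Every step with the accelerated rule is simulated by a complete \<open>d\<close>-ary tree of steps with
  \<open>\<alpha>\<close>: as long as the metering function is positive the guard holds, and passing to a child lowers
  the metering function by at most one. A tree of depth \<open>b\<close> has cost at least
  \<open>1 + d + \<dots> + d ^ (b - 1)\<close>; for real \<open>b\<close> this is the recursion
  \<open>(d powr b - 1) / (d - 1) = 1 + d * ((d powr (b - 1) - 1) / (d - 1))\<close>. Temporary variables keep
  their values along the whole tree. The simulation leaves additional terms in the configuration,
  which is harmless because derivations are monotone in the initial configuration.
\<close>

section \<open>Evaluation under changed assignments and substitutions\<close>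

lemma eval_cong: "(\<And>x. x \<in> vars e \<Longrightarrow> \<sigma> x = \<tau> x) \<Longrightarrow> eval \<sigma> e = eval \<tau> e"
  and holds_cong: "(\<And>x. x \<in> ineq_vars i \<Longrightarrow> \<sigma> x = \<tau> x) \<Longrightarrow> holds \<sigma> i = holds \<tau> i"
proof (induction e and i)
  case (Chi \<psi> t)
  have "holds \<sigma> i = holds \<tau> i" if "i \<in> set \<psi>" for i
    using that Chi by auto
  \<comment> \<open>\<open>models\<close> tests definedness as well as truth, so agreement of the
    assignments as partial maps has to transfer the domain condition too.\<close>
  moreover have "constraint_vars \<psi> \<subseteq> dom \<sigma> \<longleftrightarrow> constraint_vars \<psi> \<subseteq> dom \<tau>"
    using Chi.prems by (fastforce simp: constraint_vars_def dom_def subset_iff)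
  moreover have "eval \<sigma> t = eval \<tau> t"
    using Chi by auto
  ultimately show ?case by simp
qed auto

lemma models_cong:
  assumes "\<And>x. x \<in> constraint_vars \<phi> \<Longrightarrow> \<sigma> x = \<tau> x"
  shows "models \<sigma> \<phi> = models \<tau> \<phi>"
proof -
  have "holds \<sigma> i = holds \<tau> i" if "i \<in> set \<phi>" for i
    using that assms by (intro holds_cong) (auto simp: constraint_vars_def)
  moreover have "constraint_vars \<phi> \<subseteq> dom \<sigma> \<longleftrightarrow> constraint_vars \<phi> \<subseteq> dom \<tau>"
    using assms by (fastforce simp: dom_def subset_iff)
  ultimately show ?thesis by simp
qed

text \<open>Totality of both assignments makes the domain condition inside \<open>models\<close>
  trivial; without it, that condition could change under substitution in the \<open>Chi\<close>
  case.\<close>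

lemma eval_subst:
  assumes "dom \<sigma> = UNIV" "dom \<tau> = UNIV"
    and "\<And>x. eval \<sigma> (subst \<theta> (Var x)) = eval \<tau> (Var x)"
  shows "eval \<sigma> (subst \<theta> e) = eval \<tau> e"
    and "holds \<sigma> (subst_ineq \<theta> i) = holds \<tau> i"
proof (induction e and i)
  case (Var x)
  show ?case by (rule assms(3))
qed (use assms in auto)

text \<open>An inequation with an undefined side fails, so validity also yields values for both
  sides. This is how costs and metering values become available at the nodes of the tree.\<close>

lemma valid_ImpD:
  assumes "valid (Imp F (Constr [Le s t]))" "dom \<sigma> = UNIV" "formula_models \<sigma> F"
  obtains a r where "eval \<sigma> s = Some a" "eval \<sigma> t = Some r" "a \<le> r"
proof -
  from assms have "formula_models \<sigma> (Constr [Le s t])"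
    unfolding valid_def by fastforce
  then show thesis using that by auto
qed

section \<open>Composition and simulation of derivations\<close>

lemma step_add_right:
  assumes "step xs P S k T"
  shows "step xs P (S + U) k (T + U)"
proof -
  from assms obtain s \<beta> \<sigma> R where *: "s \<in># S" "\<beta> \<in> P" "rule_vars xs \<beta> \<subseteq> dom \<sigma>"
    "(root \<beta>, map (\<lambda>x. the (\<sigma> x)) xs) = s" "models \<sigma> (guard \<beta>)"
    "eval \<sigma> (cost \<beta>) = Some k" "eval_terms \<sigma> (rhs \<beta>) = of_config R"
    "T = (S - {#s#}) + R"
    unfolding step_def by blast
  from * have "T + U = (S + U - {#s#}) + R"
    by (simp add: ac_simps)
  moreover from * have "s \<in># S + U" by simp
  ultimately show ?thesis
    using * unfolding step_def by blast
qed

lemma steps_add_right: "steps xs P S k T \<Longrightarrow> steps xs P (S + U) k (T + U)"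
  by (induction rule: steps.induct) (auto intro: steps.intros step_add_right)

lemma steps_trans: "steps xs P S k T \<Longrightarrow> steps xs P T l U \<Longrightarrow> steps xs P S (k + l) U"
  by (induction rule: steps.induct) (auto simp: add.assoc intro: steps.intros)

lemma steps_parallel:
  assumes "steps xs P S k T" "steps xs P S' k' T'"
  shows "steps xs P (S + S') (k + k') (T + T')"
proof -
  have "steps xs P (T + S') k' (T + T')"
    using steps_add_right[OF assms(2), of T] by (simp add: add.commute)
  with steps_add_right[OF assms(1)] show ?thesis
    by (rule steps_trans)
qed

text \<open>Derivations from different terms of a configuration do not interact, so the lower bounds
  for the subtrees below siblings add up.\<close>

lemma steps_parallel_size:
  assumes "\<And>s. s \<in># R \<Longrightarrow> \<exists>k T. c \<le> k \<and> steps xs P {#s#} k T"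
  shows "\<exists>k T. real (size R) * c \<le> k \<and> steps xs P R k T"
  using assms
proof (induction R)
  case empty
  show ?case using steps_refl by fastforce
next
  case (add s R)
  from add.IH add.prems obtain k T where "real (size R) * c \<le> k" "steps xs P R k T"
    by auto
  moreover from add.prems obtain l U where "c \<le> l" "steps xs P {#s#} l U"
    by (meson union_single_eq_member)
  ultimately have "real (size (add_mset s R)) * c \<le> k + l"
    "steps xs P (R + {#s#}) (k + l) (T + U)"
    using steps_parallel by (simp add: algebra_simps, blast)
  then show ?case by auto
qed

text \<open>Surplus terms left by one simulated step persist, so the induction ranges over all
  larger start configurations \<open>S'\<close>. A step rewrites a single term \<open>s\<close>; its
  simulation runs with \<open>S' - {#s#}\<close> as context.\<close>

lemma steps_simulation:
  assumes simulation: "\<And>s k R. step xs P' {#s#} k R \<Longrightarrow>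
      \<exists>l T. k \<le> l \<and> R \<subseteq># T \<and> steps xs P {#s#} l T"
    and "steps xs P' S k T" "S \<subseteq># S'"
  shows "\<exists>l T'. k \<le> l \<and> T \<subseteq># T' \<and> steps xs P S' l T'"
  using assms(2,3)
proof (induction arbitrary: S' rule: steps.induct)
  case (steps_refl S)
  then show ?case using steps.steps_refl by blast
next
  case (steps_step S k T m U)
  from steps_step.hyps(1) obtain s \<beta> \<sigma> R where *: "s \<in># S" "\<beta> \<in> P'"
    "rule_vars xs \<beta> \<subseteq> dom \<sigma>"
    "(root \<beta>, map (\<lambda>x. the (\<sigma> x)) xs) = s" "models \<sigma> (guard \<beta>)"
    "eval \<sigma> (cost \<beta>) = Some k" "eval_terms \<sigma> (rhs \<beta>) = of_config R"
    "T = (S - {#s#}) + R"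
    unfolding step_def by blast
  then have "step xs P' {#s#} k R"
    unfolding step_def
    by (intro exI[of _ s] exI[of _ \<beta>] exI[of _ \<sigma>] exI[of _ R]) (simp del: models.simps)
  from simulation[OF this] obtain l V where l: "k \<le> l" "R \<subseteq># V" "steps xs P {#s#} l V"
    by blast
  have "steps xs P ({#s#} + (S' - {#s#})) l (V + (S' - {#s#}))"
    using l(3) by (rule steps_add_right)
  moreover have "{#s#} + (S' - {#s#}) = S'"
    using *(1) steps_step.prems by (simp add: mset_subset_eqD)
  ultimately have first: "steps xs P S' l (V + (S' - {#s#}))" by simp
  have "S - {#s#} \<subseteq># S' - {#s#}"
    using steps_step.prems by (auto simp: subseteq_mset_def diff_le_mono)
  then have "T \<subseteq># V + (S' - {#s#})"
    unfolding *(8) using l(2) by (metis add.commute subset_mset.add_mono)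
  from steps_step.IH[OF this] obtain n W where
    "m \<le> n" "U \<subseteq># W" "steps xs P (V + (S' - {#s#})) n W"
    by blast
  with first l(1) show ?case
    using steps_trans[OF first] by (meson add_mono)
qed

lemma rc_mono:
  assumes "\<And>s k T. steps xs P' {#s#} k T \<Longrightarrow> \<exists>l U. k \<le> l \<and> steps xs P {#s#} l U"
  shows "rc f0 xs P' n \<le> rc f0 xs P n"
proof -
  have "dh xs P' {#s#} \<le> dh xs P {#s#}" for s
    unfolding dh_def
  proof (rule Sup_mono)
    fix a assume "a \<in> {ereal k | k T. steps xs P' {#s#} k T}"
    then obtain k T where k: "a = ereal k" "steps xs P' {#s#} k T" by blast
    from assms[OF k(2)] obtain l U where "k \<le> l" "steps xs P {#s#} l U" by blast
    with k(1) show "\<exists>c\<in>{ereal k | k T. steps xs P {#s#} k T}. a \<le> c"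
      by (intro bexI[of _ "ereal l"]) auto
  qed
  then show ?thesis
    unfolding rc_def by (intro Sup_mono) blast
qed

section \<open>The recursion tree and its cost\<close>

locale metered_recursion =
  fixes xs :: "'v list" and P :: "('f, 'v) program" and \<alpha> :: "('f, 'v) rule" and B :: "'v aexp"
  assumes distinct: "distinct xs"
    and rule_in: "\<alpha> \<in> P"
    and arity: "\<And>g ts. (g, ts) \<in># rhs \<alpha> \<Longrightarrow> length ts = length xs"
    and wf: "well_formed_rule xs \<alpha>"
    and simple: "simple_recursion \<alpha>"
    and cost_ge_1: "valid (Imp (Constr (guard \<alpha>)) (Constr [Le (Num 1) (cost \<alpha>)]))"
    and metering: "metering_function xs \<alpha> B"
begin

abbreviation lhs_inst :: "'v int_subst \<Rightarrow> 'f \<times> int list" where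
  "lhs_inst \<sigma> \<equiv> (root \<alpha>, map (\<lambda>x. the (\<sigma> x)) xs)"

text \<open>A child is again an instance of the left-hand side: \<tau> maps program variables to the
  evaluated arguments and agrees with \<sigma> elsewhere. Hence \<open>B\<close> under \<tau> has
  the value of the substituted \<open>B\<close> under \<sigma>, which the metering condition
  bounds.\<close>

lemma rhs_instance:
  assumes total: "dom \<sigma> = UNIV" and guard: "models \<sigma> (guard \<alpha>)"
    and B: "eval \<sigma> B = Some \<beta>" and t: "t \<in># rhs \<alpha>"
  obtains \<tau> \<gamma> where "dom \<tau> = UNIV"
    "(fst t, map (eval \<sigma>) (snd t)) =
      (fst (lhs_inst \<tau>), map (\<lambda>n. Some (real_of_int n)) (snd (lhs_inst \<tau>)))"
    "eval \<tau> B = Some \<gamma>" "\<beta> - 1 \<le> \<gamma>"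
proof -
  obtain g ts where t_eq: "t = (g, ts)" by (cases t)
  with simple t have g: "g = root \<alpha>"
    by (auto simp: simple_recursion_def)
  have len: "length ts = length xs"
    using arity t t_eq by simp
  \<comment> \<open>Assignments take integer values, so well-formedness is what allows the arguments
    to be stored in \<tau>.\<close>
  have "\<exists>z::int. eval \<sigma> u = Some (of_int z)" if "u \<in> set ts" for u
  proof -
    have "models_rule xs \<sigma> \<alpha>"
      using total guard by (simp add: models_rule_def del: models.simps)
    then show ?thesis
      using wf t t_eq that unfolding well_formed_rule_def by fastforce
  qed
  then obtain z where z: "\<And>u. u \<in> set ts \<Longrightarrow> eval \<sigma> u = Some (real_of_int (z u))"
    by metis
  define \<theta> where "\<theta> = map_of (zip xs ts)"
  define \<tau> where "\<tau> x = (case \<theta> x of None \<Rightarrow> \<sigma> x | Some u \<Rightarrow> Some (z u))" for x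
  have \<sigma>_some: "\<exists>v. \<sigma> x = Some v" for x
    using total by blast
  have \<tau>_total: "dom \<tau> = UNIV"
    using \<sigma>_some by (auto simp: \<tau>_def split: option.split)
  have range: "u \<in> set ts" if "\<theta> x = Some u" for x u
    using that unfolding \<theta>_def by (metis map_of_SomeD set_zip_rightD)
  have "eval \<sigma> (subst \<theta> (Var x)) = eval \<tau> (Var x)" for x
    using z range by (auto simp: \<tau>_def split: option.split)
  then have substB: "eval \<sigma> (subst \<theta> B) = eval \<tau> B"
    using eval_subst(1) total \<tau>_total by blast
  \<comment> \<open>Distinctness of \<open>xs\<close> ensures that looking up the variable at
    position \<open>i\<close> finds the argument at position \<open>i\<close>.\<close>
  have "\<tau> (xs ! i) = Some (z (ts ! i))" if "i < length xs" for i
    using that len distinct by (simp add: \<tau>_def \<theta>_def map_of_zip_nth)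
  then have "map (eval \<sigma>) ts = map (\<lambda>n. Some (real_of_int n)) (snd (lhs_inst \<tau>))"
    using len z by (intro nth_equalityI) auto
  moreover have "valid (Imp (Constr (guard \<alpha>)) (Constr [Le (Sub B (Num 1)) (subst \<theta> B)]))"
    using metering t t_eq unfolding metering_function_def \<theta>_def by fastforce
  from this total obtain a r where "eval \<sigma> (Sub B (Num 1)) = Some a" "eval \<sigma> (subst \<theta> B) = Some r"
    "a \<le> r"
    using guard by (elim valid_ImpD) (auto simp del: models.simps)
  then have "eval \<tau> B = Some r" "\<beta> - 1 \<le> r"
    using B substB by (auto simp: lift_opt_def)
  ultimately show thesis
    using that[of \<tau> r] \<tau>_total g t_eq by simp
qed

lemma recursion_step:
  assumes total: "dom \<sigma> = UNIV" and guard: "models \<sigma> (guard \<alpha>)"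
    and B: "eval \<sigma> B = Some \<beta>"
  obtains c R where "1 \<le> c" "step xs P {#lhs_inst \<sigma>#} c R" "size R = degree \<alpha>"
    "\<And>s. s \<in># R \<Longrightarrow> \<exists>\<tau> \<gamma>. dom \<tau> = UNIV \<and> s = lhs_inst \<tau> \<and> eval \<tau> B = Some \<gamma> \<and> \<beta> - 1 \<le> \<gamma>"
proof -
  obtain c where c: "eval \<sigma> (cost \<alpha>) = Some c" "1 \<le> c"
    using cost_ge_1 total guard by (elim valid_ImpD) (auto simp del: models.simps)
  have "\<exists>\<tau>. dom \<tau> = UNIV \<and> (fst t, map (eval \<sigma>) (snd t)) =
      (fst (lhs_inst \<tau>), map (\<lambda>n. Some (real_of_int n)) (snd (lhs_inst \<tau>))) \<and>
      (\<exists>\<gamma>. eval \<tau> B = Some \<gamma> \<and> \<beta> - 1 \<le> \<gamma>)"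
    if "t \<in># rhs \<alpha>" for t
    using rhs_instance[OF assms that] by metis
  then obtain \<tau> where \<tau>: "\<And>t. t \<in># rhs \<alpha> \<Longrightarrow> dom (\<tau> t) = UNIV \<and>
      (fst t, map (eval \<sigma>) (snd t)) =
      (fst (lhs_inst (\<tau> t)), map (\<lambda>n. Some (real_of_int n)) (snd (lhs_inst (\<tau> t)))) \<and>
      (\<exists>\<gamma>. eval (\<tau> t) B = Some \<gamma> \<and> \<beta> - 1 \<le> \<gamma>)"
    by metis
  \<comment> \<open>One assignment is chosen per term; taking the image as a multiset keeps
    multiplicities, so the node has exactly \<open>degree \<alpha>\<close> children.\<close>
  define R where "R = image_mset (\<lambda>t. lhs_inst (\<tau> t)) (rhs \<alpha>)"
  have "eval_terms \<sigma> (rhs \<alpha>) = of_config R"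
    unfolding eval_terms_def of_config_def R_def multiset.map_comp
    by (rule image_mset_cong) (use \<tau> in \<open>auto simp: case_prod_beta\<close>)
  then have "step xs P {#lhs_inst \<sigma>#} c R"
    using rule_in total guard c unfolding step_def
    by (intro exI[of _ "lhs_inst \<sigma>"] exI[of _ \<alpha>] exI[of _ \<sigma>] exI[of _ R])
      (simp del: models.simps)
  moreover have "size R = degree \<alpha>"
    by (simp add: R_def degree_def)
  moreover have "\<exists>\<tau> \<gamma>. dom \<tau> = UNIV \<and> s = lhs_inst \<tau> \<and> eval \<tau> B = Some \<gamma> \<and> \<beta> - 1 \<le> \<gamma>"
    if "s \<in># R" for s
  proof -
    from that obtain t where "t \<in># rhs \<alpha>" "s = lhs_inst (\<tau> t)"
      unfolding R_def set_image_mset by blast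
    with \<tau> show ?thesis by blast
  qed
  ultimately show thesis
    using that c by blast
qed

lemma degree_gt_1: "1 < real (degree \<alpha>)"
  using simple by (simp add: simple_recursion_def)

text \<open>
  The bound \<open>r\<close> is decoupled from the value of the metering function because the latter may grow
  along a step, so that the induction is on \<open>r\<close>.
\<close>

lemma steps_cost_ge:
  assumes "dom \<sigma> = UNIV" "eval \<sigma> B = Some \<beta>" "r \<le> \<beta>" "r \<le> real n"
  shows "\<exists>k T. (real (degree \<alpha>) powr r - 1) / (real (degree \<alpha>) - 1) \<le> k \<and>
    steps xs P {#lhs_inst \<sigma>#} k T"
  using assms
proof (induction n arbitrary: \<sigma> \<beta> r)
  let ?d = "real (degree \<alpha>)"
  let ?c = "\<lambda>r. (?d powr r - 1) / (?d - 1)"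
  \<comment> \<open>At a leaf the bound is nonpositive, so the empty derivation of cost 0
    suffices.\<close>
  have nonpos: "?c r \<le> 0" if "r \<le> 0" for r
    using degree_gt_1 powr_mono[OF that, of ?d] by (simp add: divide_nonpos_pos)
  {
    case 0
    then show ?case using nonpos[of r] steps_refl by fastforce
  next
    case (Suc n)
    show ?case
    proof (cases "r \<le> 0")
      case True
      then show ?thesis using nonpos[of r] steps_refl by fastforce
    next
      case False
      \<comment> \<open>Here 0 < \<open>r\<close> \<le> \<beta>, whereas a failing guard would force
        the metering function to be at most 0.\<close>
      have guard: "models \<sigma> (guard \<alpha>)"
      proof (rule ccontr)
        assume "\<not> models \<sigma> (guard \<alpha>)"
        then have "formula_models \<sigma> (Neg (Constr (guard \<alpha>)))"
          by (simp del: models.simps)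
        moreover have "valid (Imp (Neg (Constr (guard \<alpha>))) (Constr [Le B (Num 0)]))"
          using metering by (simp add: metering_function_def)
        ultimately obtain a z where "eval \<sigma> B = Some a" "eval \<sigma> (Num 0) = Some z" "a \<le> z"
          using Suc.prems(1) valid_ImpD by blast
        with False Suc.prems show False by simp
      qed
      obtain c R where c: "1 \<le> c" and step: "step xs P {#lhs_inst \<sigma>#} c R"
        and size: "size R = degree \<alpha>"
        and R: "\<And>s. s \<in># R \<Longrightarrow>
          \<exists>\<tau> \<gamma>. dom \<tau> = UNIV \<and> s = lhs_inst \<tau> \<and> eval \<tau> B = Some \<gamma> \<and> \<beta> - 1 \<le> \<gamma>"
        using recursion_step[OF Suc.prems(1) guard Suc.prems(2)] by blast
      have "\<exists>k T. ?c (r - 1) \<le> k \<and> steps xs P {#s#} k T" if s: "s \<in># R" for s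
      proof -
        from R[OF s] obtain \<tau> \<gamma> where \<tau>: "dom \<tau> = UNIV" "s = lhs_inst \<tau>"
          "eval \<tau> B = Some \<gamma>" "\<beta> - 1 \<le> \<gamma>" by blast
        then show ?thesis
          using Suc.IH[of \<tau> \<gamma> "r - 1"] Suc.prems by simp
      qed
      then have "\<exists>k T. real (size R) * ?c (r - 1) \<le> k \<and> steps xs P R k T"
        by (rule steps_parallel_size)
      then obtain k T where k: "?d * ?c (r - 1) \<le> k" and steps: "steps xs P R k T"
        unfolding size by (elim exE conjE)
      have "?d powr r = ?d * ?d powr (r - 1)"
        using degree_gt_1 by (simp add: powr_mult_base)
      then have "?c r = 1 + ?d * ?c (r - 1)"
        using degree_gt_1 by (simp add: divide_simps) (simp add: algebra_simps)
      also have "\<dots> \<le> c + k"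
        using c k by linarith
      finally show ?thesis
        using steps_step[OF step steps] by blast
    qed
  }
qed

end

section \<open>Soundness of the accelerated rule\<close>

lemma accelerated_step_simulation:
  assumes "metered_recursion xs P \<alpha> (Chi \<psi> b)"
    and "step xs (P \<union> {accelerated_rule \<alpha> \<psi> b}) {#s#} k R"
  shows "\<exists>l T. k \<le> l \<and> R \<subseteq># T \<and> steps xs P {#s#} l T"
proof -
  interpret metered_recursion xs P \<alpha> "Chi \<psi> b" by fact
  let ?d = "real (degree \<alpha>)"
  from assms(2) obtain \<beta> \<sigma> where *: "\<beta> \<in> P \<union> {accelerated_rule \<alpha> \<psi> b}"
    "rule_vars xs \<beta> \<subseteq> dom \<sigma>"
    "(root \<beta>, map (\<lambda>x. the (\<sigma> x)) xs) = s" "models \<sigma> (guard \<beta>)"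
    "eval \<sigma> (cost \<beta>) = Some k" "eval_terms \<sigma> (rhs \<beta>) = of_config R"
    unfolding step_def by (auto simp del: models.simps)
  show ?thesis
  proof (cases "\<beta> \<in> P")
    case True
    with * have "step xs P {#s#} k R"
      unfolding step_def
      by (intro exI[of _ s] exI[of _ \<beta>] exI[of _ \<sigma>] exI[of _ R]) (simp del: models.simps)
    from steps_step[OF this steps_refl] show ?thesis
      by auto
  next
    case False
    with * have \<beta>: "\<beta> = accelerated_rule \<alpha> \<psi> b" by simp
    \<comment> \<open>The accelerated rule erases its redex, so whatever the tree of \<alpha>-steps
      leaves behind contains \<open>R\<close>.\<close>
    have R: "R = {#}"
      using *(6)[symmetric]
      by (simp add: \<beta> accelerated_rule_def eval_terms_def of_config_def Let_def)
    \<comment> \<open>\<sigma> need only cover the variables of the accelerated rule, while steps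
      with \<alpha> may involve further temporary variables; these get the default value 0.\<close>
    define \<tau> where "\<tau> x = Some (case \<sigma> x of None \<Rightarrow> 0 | Some v \<Rightarrow> v)" for x
    have total: "dom \<tau> = UNIV" by (auto simp: \<tau>_def)
    have vars: "set xs \<union> vars b \<union> constraint_vars \<psi> \<subseteq> dom \<sigma>"
      using *(2) by (auto simp: \<beta> accelerated_rule_def rule_vars_def constraint_vars_def Let_def)
    have \<tau>_eq: "\<sigma> x = \<tau> x" if "x \<in> dom \<sigma>" for x
      using that by (auto simp: \<tau>_def)
    have lhs: "s = lhs_inst \<tau>"
      using *(3) vars \<tau>_eq by (auto simp: \<beta> accelerated_rule_def Let_def subset_iff)
    \<comment> \<open>Since \<psi> is part of the new guard, \<open>Chi \<psi> b\<close> takes the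
      value of \<open>b\<close> and not the default 0.\<close>
    have "models \<sigma> \<psi>"
      using *(4) by (simp add: \<beta> accelerated_rule_def constraint_vars_def Let_def)
    moreover have "models \<sigma> \<psi> = models \<tau> \<psi>" "eval \<sigma> b = eval \<tau> b"
      using vars by (auto intro!: models_cong eval_cong \<tau>_eq simp del: models.simps)
    \<comment> \<open>The step has a defined cost, which forces its exponent \<open>b\<close> to be
      defined.\<close>
    moreover obtain r where r: "eval \<sigma> b = Some r"
      using *(5) by (cases "eval \<sigma> b") (auto simp: \<beta> accelerated_rule_def lift_opt_def Let_def)
    ultimately have "eval \<tau> (Chi \<psi> b) = Some r"
      by (simp del: models.simps)
    \<comment> \<open>As the degree exceeds 1, the power falls into the \<open>powr\<close> branch
      and the denominator is nonzero.\<close>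
    moreover have "k = (?d powr r - 1) / (?d - 1)"
      using *(5) r degree_gt_1
      by (simp add: \<beta> accelerated_rule_def lift_opt_def pow_opt_def div_opt_def Let_def
          split: if_splits)
    \<comment> \<open>The bound \<open>r\<close> is taken to be the metering value itself, and the
      induction runs up to the ceiling of \<open>r\<close>, since \<open>b\<close> may be
      fractional.\<close>
    ultimately show ?thesis
      using steps_cost_ge[OF total _ order.refl real_nat_ceiling_ge, of r] R lhs by auto
  qed
qed

theorem theorem4p5:
  fixes \<Sigma> :: "'f set" and f0 :: 'f and xs :: "'v list"
    and P P' :: "('f, 'v) program" and \<alpha> :: "('f, 'v) rule"
    and \<psi> :: "'v constraint" and b :: "'v aexp"
  assumes "finite \<Sigma>" and "f0 \<in> \<Sigma>" and "distinct xs"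
    and "integer_program \<Sigma> f0 xs P" and "well_formed xs P"
    and "\<alpha> \<in> P" and "simple_recursion \<alpha>"
    and "valid (Imp (Constr (guard \<alpha>)) (Constr [Le (Num 1) (cost \<alpha>)]))"
    and "metering_function xs \<alpha> (Chi \<psi> b)"
    and "P' = P \<union> {accelerated_rule \<alpha> \<psi> b}"
  shows "well_formed xs P' \<and> processor \<Sigma> f0 xs [P \<mapsto> P'] \<and> sound f0 xs [P \<mapsto> P']"
proof (intro conjI)
  have \<alpha>: "is_rule \<Sigma> xs \<alpha>" "well_formed_rule xs \<alpha>"
    using assms by (auto simp: integer_program_def well_formed_def)
  \<comment> \<open>The new right-hand side is empty, so the conditions on its terms, here and for
    \<open>integer_program\<close> below, hold vacuously.\<close>
  show "well_formed xs P'"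
    using assms(5) unfolding assms(10)
    by (auto simp: well_formed_def well_formed_rule_def accelerated_rule_def Let_def)
  have "integer_program \<Sigma> f0 xs P'"
    using assms(4) \<alpha>(1) unfolding assms(10)
    by (auto simp: integer_program_def is_rule_def accelerated_rule_def Let_def)
  then show "processor \<Sigma> f0 xs [P \<mapsto> P']"
    using assms(4) by (auto simp: processor_def split: if_splits)
  have "metered_recursion xs P \<alpha> (Chi \<psi> b)"
    using assms \<alpha> by unfold_locales (auto simp: is_rule_def)
  note simulation = accelerated_step_simulation[OF this]
  \<comment> \<open>Both derivations start from the same singleton; containment of configurations is
    only needed to carry the simulation past its first step.\<close>
  have "\<exists>l U. k \<le> l \<and> steps xs P {#s#} l U" if "steps xs P' {#s#} k T" for s k T
    using steps_simulation[OF simulation that[unfolded assms(10)] subset_mset.order_refl] by blast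
  then have "rc f0 xs P' n \<le> rc f0 xs P n" for n
    by (rule rc_mono)
  then show "sound f0 xs [P \<mapsto> P']"
    by (auto simp: sound_def split: if_splits)
qed

end
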